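(* Let $q$ be a prime power, let $0<p\le 1$, put $n=\left\lceil \frac1p\right\rceil$, and suppose $q\ge \frac{n(n-1)}{2}$. Then $$\omega(\mathrm{CHSH}_q(p))\le p+\frac{n-1}{q}\left(1-\frac{np}{2}\right).$$
   Context: Let $\mathbb{F}_q$ be the finite field with $q$ elements. $\mathrm{CHSH}_q(p)$ is the family of two-player games, one for each probability distribution $r$ on $\mathbb{F}_q$ with $\max_{x\in\mathbb{F}_q} r(x)\le p$: Alice receives $x\in\mathbb{F}_q$ drawn according to $r$, Bob receives $y\in\mathbb{F}_q$ drawn uniformly and independently of $x$; without communicating they output $a,b\in\mathbb{F}_q$ respectively, and win iff $a+b=xy$ in $\mathbb{F}_q$. Only deterministic classical strategies are considered, i.e. pairs of functions $a,b:\mathbb{F}_q\to\mathbb{F}_q$ (Alice answers $a(x)$, Bob answers $b(y)$). For such a strategy the winning probability is $$\omega(q,p,r,a,b)=\sum_{x,y\in\mathbb{F}_q}\frac1q\, r(x)\,V(a,b,x,y),$$ where $V(a,b,x,y)=1$ if $a(x)+b(y)=xy$ and $0$ otherwise. The classical value of the family is $$\omega(\mathrm{CHSH}_q(p))=\max_{r}\max_{a,b}\ \omega(q,p,r,a,b),$$ the maximum being over all probability distributions $r$ on $\mathbb{F}_q$ with $\max_x r(x)\le p$ and all functions $a,b:\mathbb{F}_q\to\mathbb{F}_q$. *)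

theory Defs
  imports "HOL-Probability.Probability"
begin

text \<open>
  The field with \<open>q\<close> elements is an arbitrary type of classes \<open>field\<close> and \<open>finite\<close>; \<open>q\<close> is its
  cardinality.
\<close>

definition chsh_inputs :: "real \<Rightarrow> ('a::finite) pmf set" where
  "chsh_inputs p = {r. Max (range (pmf r)) \<le> p}"

definition chsh_V :: "('a::field \<Rightarrow> 'a) \<Rightarrow> ('a \<Rightarrow> 'a) \<Rightarrow> 'a \<Rightarrow> 'a \<Rightarrow> real" where
  "chsh_V a b x y = (if a x + b y = x * y then 1 else 0)"

definition chsh_win ::
    "('a::{field,finite}) pmf \<Rightarrow> ('a \<Rightarrow> 'a) \<Rightarrow> ('a \<Rightarrow> 'a) \<Rightarrow> real" where
  "chsh_win r a b = (\<Sum>x\<in>UNIV. \<Sum>y\<in>UNIV. 1 / real CARD('a) * pmf r x * chsh_V a b x y)"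

text \<open>
  The maximum ranges over an infinite set of distributions, so \<open>Max\<close> does not apply. The set is
  empty, and the value unspecified, when \<open>p < 1 / q\<close>; otherwise the maximum is attained (see below).
\<close>

definition chsh_value :: "('a::{field,finite}) itself \<Rightarrow> real \<Rightarrow> real" where
  "chsh_value _ p = (GREATEST w. \<exists>r \<in> chsh_inputs p. \<exists>a b :: 'a \<Rightarrow> 'a. w = chsh_win r a b)"

lemma chsh_inputs_iff: "r \<in> chsh_inputs p \<longleftrightarrow> (\<forall>x. pmf r x \<le> p)"
  by (simp add: chsh_inputs_def)

lemma chsh_max_exists:
  assumes p: "1 / real CARD('a::{field,finite}) \<le> p"
  shows "\<exists>r \<in> chsh_inputs p. \<exists>a b :: 'a \<Rightarrow> 'a.
           \<forall>r' \<in> chsh_inputs p. \<forall>a' b' :: 'a \<Rightarrow> 'a. chsh_win r' a' b' \<le> chsh_win r a b"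
proof -
  define K :: "((real, 'a) vec) set" where
    "K = {v \<in> cbox 0 (\<chi> i. p). (\<Sum>i\<in>UNIV. v $ i) = 1}"
  define W :: "('a \<Rightarrow> 'a) \<Rightarrow> ('a \<Rightarrow> 'a) \<Rightarrow> (real, 'a) vec \<Rightarrow> real" where
    "W a b v = (\<Sum>x\<in>UNIV. \<Sum>y\<in>UNIV. 1 / real CARD('a) * v $ x * chsh_V a b x y)" for a b v
  have "closed {v :: (real, 'a) vec. (\<Sum>i\<in>UNIV. v $ i) = 1}"
    by (intro closed_Collect_eq continuous_intros)
  then have cK: "compact K"
    unfolding K_def by (metis Collect_conj_eq Collect_mem_eq compact_Int_closed compact_cbox)
  have "(\<chi> i. 1 / real CARD('a)) \<in> K"
    using p by (simp add: K_def mem_box_cart)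
  then have nK: "K \<noteq> {}" by auto
  have cW: "compact (W a b ` K)" for a b
    unfolding W_def by (intro compact_continuous_image cK continuous_intros)
  have "finite (UNIV :: (('a \<Rightarrow> 'a) \<times> ('a \<Rightarrow> 'a)) set)" by simp
  then have cU: "compact (\<Union>(a, b) \<in> UNIV. W a b ` K)"
    using cW by (intro compact_UN) auto
  have "(\<Union>(a, b) \<in> UNIV. W a b ` K) \<noteq> {}" using nK by auto
  from compact_attains_sup[OF cU this] obtain a b v where v: "v \<in> K"
    and mx: "\<And>a' b' v'. v' \<in> K \<Longrightarrow> W a' b' v' \<le> W a b v"
    by (auto simp: Ball_def) blast
  define r where "r = embed_pmf (\<lambda>x. v $ x)"
  have v0: "0 \<le> v $ x" and vp: "v $ x \<le> p" for x
    using v by (auto simp: K_def mem_box_cart)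
  have "(\<integral>\<^sup>+x. ennreal (v $ x) \<partial>count_space UNIV) = ennreal (\<Sum>x\<in>UNIV. v $ x)"
    using v0 by (simp add: nn_integral_count_space_finite sum_ennreal)
  also have "\<dots> = 1" using v by (simp add: K_def)
  finally have pr: "pmf r x = v $ x" for x
    unfolding r_def by (intro pmf_embed_pmf) (use v0 in auto)
  have "chsh_win r' a' b' \<le> chsh_win r a b" if "r' \<in> chsh_inputs p" for r' and a' b' :: "'a \<Rightarrow> 'a"
  proof -
    have "(\<Sum>x\<in>UNIV. pmf r' x) = 1" by (rule sum_pmf_eq_1) auto
    then have "(\<chi> x. pmf r' x) \<in> K"
      using that by (simp add: K_def mem_box_cart chsh_inputs_iff)
    from mx[OF this, of a' b'] show ?thesis by (simp add: W_def chsh_win_def pr)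
  qed
  moreover have "r \<in> chsh_inputs p" using vp by (simp add: chsh_inputs_iff pr)
  ultimately show ?thesis by blast
qed

lemma chsh_value_is_max:
  assumes p: "1 / real CARD('a::{field,finite}) \<le> p"
  shows "\<exists>r \<in> chsh_inputs p. \<exists>a b :: 'a \<Rightarrow> 'a. chsh_value TYPE('a) p = chsh_win r a b"
    and "\<And>(r :: 'a pmf) a b. r \<in> chsh_inputs p \<Longrightarrow> chsh_win r a b \<le> chsh_value TYPE('a) p"
proof -
  from chsh_max_exists[OF p] obtain r and a b :: "'a \<Rightarrow> 'a" where r: "r \<in> chsh_inputs p"
    and mx: "\<And>r' (a' :: 'a \<Rightarrow> 'a) b'. r' \<in> chsh_inputs p \<Longrightarrow> chsh_win r' a' b' \<le> chsh_win r a b"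
    by blast
  have eq: "chsh_value TYPE('a) p = chsh_win r a b"
    unfolding chsh_value_def by (rule Greatest_equality) (use r mx in auto)
  show "\<exists>r \<in> chsh_inputs p. \<exists>a b :: 'a \<Rightarrow> 'a. chsh_value TYPE('a) p = chsh_win r a b"
    using r eq by blast
  show "\<And>(r :: 'a pmf) a b. r \<in> chsh_inputs p \<Longrightarrow> chsh_win r a b \<le> chsh_value TYPE('a) p"
    using mx eq by simp
qed

end

(*
  For a fixed pair of strategies let A y be the set of inputs x on which Alice's answer wins against
  Bob's answer to y. Since the lines of slopes x and x' (x \<noteq> x') meet exactly once, a pair {x, x'}
  lies in at most one A y. Writing d x for the number of y with x in A y, the inequality
  k \<le> 1 + (k choose 2) gives sum d S \<le> q + (card S choose 2) for every S.
  The winning probability is (1 / q) times the average of d under r. Among weights bounded by p the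
  average is largest when n - 1 inputs with the largest d carry weight p and the next one carries
  the rest s = 1 - (n - 1) p; writing the resulting value as s times the sum over n inputs plus
  p - s times the sum over n - 1 inputs and bounding both sums gives the claim.
*)
theory Submission
  imports Defs
begin

lemma le_Suc_choose_two: "k \<le> Suc (k choose 2)"
proof (induction k)
  case (Suc k)
  then show ?case by (cases k) (auto simp: numeral_2_eq_2)
qed simp

text \<open>Every 2-subset of \<open>S\<close> lies in at most one \<open>A y\<close>, so the
  families \<open>P y\<close> of 2-subsets of \<open>S \<inter> A y\<close> are disjoint and have at
  most \<open>card S choose 2\<close> members in total. Each \<open>card (S \<inter> A y)\<close>
  exceeds \<open>card (P y)\<close> by at most 1, which costs \<open>card Y\<close>.\<close>

lemma sum_card_le_if_pairs_unique:
  fixes A :: "'b \<Rightarrow> 'c set"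
  assumes "finite Y" and S: "finite S"
    and uniq: "\<And>x x' y y'. \<lbrakk>y \<in> Y; y' \<in> Y; x \<noteq> x'; {x, x'} \<subseteq> A y; {x, x'} \<subseteq> A y'\<rbrakk> \<Longrightarrow> y = y'"
  shows "(\<Sum>y\<in>Y. card (S \<inter> A y)) \<le> card Y + (card S choose 2)"
proof -
  define P where "P y = {B. B \<subseteq> S \<inter> A y \<and> card B = 2}" for y
  have "(\<Sum>y\<in>Y. card (P y)) = card (\<Union>y\<in>Y. P y)"
  proof (rule card_UN_disjoint[symmetric])
    show "\<forall>y\<in>Y. finite (P y)" using S by (auto simp: P_def)
    show "\<forall>y\<in>Y. \<forall>y'\<in>Y. y \<noteq> y' \<longrightarrow> P y \<inter> P y' = {}"
    proof (intro ballI impI, rule ccontr)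
      fix y y' assume y: "y \<in> Y" "y' \<in> Y" "y \<noteq> y'" and "P y \<inter> P y' \<noteq> {}"
      then obtain B where B: "B \<in> P y" "B \<in> P y'" by blast
      then obtain x x' where "B = {x, x'}" "x \<noteq> x'" by (auto simp: P_def card_2_iff)
      with B uniq y show False by (simp add: P_def)
    qed
  qed (fact \<open>finite Y\<close>)
  also have "\<dots> \<le> card {B. B \<subseteq> S \<and> card B = 2}"
    using S by (intro card_mono) (auto simp: P_def)
  also have "\<dots> = card S choose 2" by (rule n_subsets[OF S])
  finally have pairs: "(\<Sum>y\<in>Y. card (P y)) \<le> card S choose 2" .
  have "(\<Sum>y\<in>Y. card (S \<inter> A y)) \<le> (\<Sum>y\<in>Y. Suc (card (P y)))"
    unfolding P_def using S by (intro sum_mono) (subst n_subsets, simp_all add: le_Suc_choose_two)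
  also have "\<dots> = card Y + (\<Sum>y\<in>Y. card (P y))" by (simp add: sum.distrib sum_Suc)
  finally show ?thesis using pairs by linarith
qed

lemma ex_top_subset:
  fixes d :: "'b \<Rightarrow> 'c::linorder"
  assumes U: "finite U" and "k \<le> card U"
  shows "\<exists>T\<subseteq>U. card T = k \<and> (\<forall>x\<in>T. \<forall>z\<in>U - T. d z \<le> d x)"
  using assms(2)
proof (induction k)
  case 0
  then show ?case by (intro exI[of _ "{}"]) auto
next
  case (Suc k)
  then obtain T where T: "T \<subseteq> U" "card T = k" "\<forall>x\<in>T. \<forall>z\<in>U - T. d z \<le> d x" by auto
  have fT: "finite T" using T(1) U finite_subset by blast
  have "U - T \<noteq> {}" using Suc.prems T U by (metis Diff_eq_empty_iff card_mono fT not_less_eq_eq)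
  then have ne: "d ` (U - T) \<noteq> {}" by simp
  \<comment> \<open>Greedy choice: a maximiser \<open>m\<close> outside \<open>T\<close> is
    dominated by all of \<open>T\<close> and dominates what remains.\<close>
  from Max_in[OF _ ne] obtain m where m: "m \<in> U - T" "d m = Max (d ` (U - T))"
    using U by auto
  then have mx: "d z \<le> d m" if "z \<in> U - T" for z using U that by simp
  show ?case
  proof (intro exI[of _ "insert m T"] conjI)
    show "\<forall>x\<in>insert m T. \<forall>z\<in>U - insert m T. d z \<le> d x" using mx T(3) by auto
  qed (use m T fT in auto)
qed

lemma weighted_sum_le_of_bounded_weights:
  fixes r d :: "'b \<Rightarrow> real"
  assumes U: "finite U" and r0: "\<And>x. x \<in> U \<Longrightarrow> 0 \<le> r x" and rp: "\<And>x. x \<in> U \<Longrightarrow> r x \<le> p"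
    and r1: "sum r U = 1" and k: "k < card U" and kp: "real k * p \<le> 1" "1 \<le> real (Suc k) * p"
    and d: "\<And>S. S \<subseteq> U \<Longrightarrow> sum d S \<le> q + real (card S choose 2)"
  shows "(\<Sum>x\<in>U. r x * d x) \<le> p * q + real k * (1 - (real k + 1) * p / 2)"
proof -
  obtain T where T: "T \<subseteq> U" "card T = k" and top: "\<forall>x\<in>T. \<forall>z\<in>U - T. d z \<le> d x"
    using ex_top_subset[OF U, of k d] k by auto
  have fT: "finite T" using T(1) U finite_subset by blast
  have fUT: "finite (U - T)" using U by simp
  have "card (U - T) > 0" using T k U fT by (simp add: card_Diff_subset)
  then have "d ` (U - T) \<noteq> {}" by force
  from Max_in[OF _ this] obtain m where m: "m \<in> U - T" "d m = Max (d ` (U - T))"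
    using U by auto
  then have mx: "d z \<le> d m" if "z \<in> U - T" for z using U that by simp
  \<comment> \<open>The threshold \<open>t\<close> makes \<open>d x - t\<close> nonnegative on
    \<open>T\<close> and nonpositive off it, so \<open>r x\<close> may be replaced by
    \<open>p\<close> on \<open>T\<close> and by 0 elsewhere. The weight left for \<open>m\<close> is
    \<open>s\<close>; \<open>kp\<close> gives \<open>0 \<le> s \<le> p\<close>.\<close>
  define t where "t = d m"
  define s where "s = 1 - real k * p"
  have "(\<Sum>x\<in>U. r x * d x) = t * sum r U + (\<Sum>x\<in>U. r x * (d x - t))"
    by (simp add: right_diff_distrib sum_subtractf sum_distrib_left mult.commute)
  also have "\<dots> = t + (\<Sum>x\<in>U. r x * (d x - t))" by (simp add: r1)
  also have "(\<Sum>x\<in>U. r x * (d x - t)) = (\<Sum>x\<in>U - T. r x * (d x - t)) + (\<Sum>x\<in>T. r x * (d x - t))"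
    using sum.subset_diff[OF T(1) U] by simp
  also have "(\<Sum>x\<in>U - T. r x * (d x - t)) \<le> 0"
    using r0 mx by (intro sum_nonpos mult_nonneg_nonpos) (auto simp: t_def)
  also have "(\<Sum>x\<in>T. r x * (d x - t)) \<le> (\<Sum>x\<in>T. p * (d x - t))"
    using rp T(1) top m(1) by (intro sum_mono mult_right_mono) (auto simp: t_def)
  also have "(\<Sum>x\<in>T. p * (d x - t)) = p * sum d T - real k * p * t"
    using T(2) by (simp add: right_diff_distrib sum_subtractf sum_distrib_left)
  finally have "(\<Sum>x\<in>U. r x * d x) \<le> p * sum d T + s * t"
    by (simp add: s_def algebra_simps)
  \<comment> \<open>Both coefficients are now nonnegative, and \<open>d\<close> bounds each of the
    two sums.\<close>
  also have "\<dots> = s * sum d (insert m T) + (p - s) * sum d T"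
    using m(1) fT by (simp add: t_def algebra_simps)
  also have "\<dots> \<le> s * (q + real (Suc k choose 2)) + (p - s) * (q + real (k choose 2))"
  proof (intro add_mono mult_left_mono)
    show "sum d (insert m T) \<le> q + real (Suc k choose 2)"
      using d[of "insert m T"] m(1) T fT by simp
    show "sum d T \<le> q + real (k choose 2)" using d[OF T(1)] T(2) by simp
  qed (use kp in \<open>auto simp: s_def algebra_simps\<close>)
  also have "\<dots> = p * q + p * real (k choose 2) + s * real k"
    by (simp add: numeral_2_eq_2 algebra_simps)
  also have "real (k choose 2) = real k * (real k - 1) / 2"
    using choose_two[of k] by (cases k) (auto simp: real_of_nat_div field_simps)
  finally show ?thesis by (simp add: s_def field_simps)
qed

lemma chsh_win_eq:
  fixes r :: "'a::{field,finite} pmf"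
  shows "chsh_win r a b
    = (\<Sum>x\<in>UNIV. pmf r x * real (card {y. a x + b y = x * y})) / real CARD('a)"
proof -
  have "(\<Sum>y\<in>UNIV. chsh_V a b x y) = real (card {y. a x + b y = x * y})" for x
    by (simp add: chsh_V_def sum.If_cases)
  then show ?thesis
    unfolding chsh_win_def sum_distrib_left[symmetric] by (simp add: sum_divide_distrib)
qed

lemma sum_winning_inputs_le:
  fixes a b :: "'a::{field,finite} \<Rightarrow> 'a"
  shows "(\<Sum>x\<in>S. card {y. a x + b y = x * y}) \<le> CARD('a) + (card S choose 2)"
proof -
  define A where "A y = {x. a x + b y = x * y}" for y
  \<comment> \<open>Double counting of the winning pairs \<open>(x, y)\<close> with
    \<open>x \<in> S\<close>.\<close>
  have "(\<Sum>x\<in>S. card {y. a x + b y = x * y}) = (\<Sum>y\<in>UNIV. card (S \<inter> A y))"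
    using sum.swap_restrict[of S UNIV "\<lambda>_ _. 1 :: nat" "\<lambda>x y. a x + b y = x * y"]
    by (simp add: A_def Int_def)
  also have "\<dots> \<le> CARD('a) + (card S choose 2)"
  proof (rule sum_card_le_if_pairs_unique)
    fix x x' y y' assume ne: "x \<noteq> x'" and "{x, x'} \<subseteq> A y" "{x, x'} \<subseteq> A y'"
    then have E: "x * y = a x + b y" "x' * y = a x' + b y" "x * y' = a x + b y'" "x' * y' = a x' + b y'"
      by (simp_all add: A_def)
    \<comment> \<open>Subtraction cancels Bob's answer: both sides equal
      \<open>a x - a x'\<close>.\<close>
    have "(x - x') * y = (x - x') * y'" unfolding left_diff_distrib E by simp
    with ne show "y = y'" by simp
  qed auto
  finally show ?thesis .
qed

theorem mainTheorem1:
  fixes p :: real and q :: nat and n :: int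
  assumes "q = CARD('a::{field,finite})"
    and "0 < p" and "p \<le> 1"
    and "n = \<lceil>1 / p\<rceil>"
    and "real q \<ge> real_of_int n * (real_of_int n - 1) / 2"
  shows "chsh_value TYPE('a) p
           \<le> p + (real_of_int n - 1) / real q * (1 - real_of_int n * p / 2)"
proof -
  have "card {0, 1 :: 'a} \<le> q" unfolding assms(1) by (intro card_mono) auto
  then have q2: "2 \<le> q" by simp
  have n1: "1 \<le> n" using assms(2-4) by (simp add: one_le_ceiling)
  \<comment> \<open>\<open>k = n - 1\<close> is the number of inputs that can carry the full weight
    \<open>p\<close>.\<close>
  then obtain k where k: "n = int (Suc k)"
    using that[of "nat (n - 1)"] by simp
  have n_ge: "1 / p \<le> real (Suc k)" and n_lt: "real k < 1 / p"
    using ceiling_correct[of "1 / p"] unfolding assms(4)[symmetric] k by simp_all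
  (* The hypothesis on q rules out the junk case of an empty set of distributions. *)
  have kq: "Suc k \<le> q"
  proof (rule ccontr)
    assume "\<not> Suc k \<le> q"
    \<comment> \<open>If \<open>q \<le> k\<close>, then
      \<open>(q + 1) * q \<le> n * (n - 1) \<le> 2 * q\<close>, which forces
      \<open>q \<le> 1\<close>.\<close>
    then have "(real q + 1) * real q \<le> real (Suc k) * real k" by (intro mult_mono) auto
    then have "(real q + 1) * real q \<le> 2 * real q" using assms(5) k by simp
    then show False using q2 by simp
  qed
  have kp: "real k * p \<le> 1" "1 \<le> real (Suc k) * p"
    using n_ge n_lt assms(2) by (auto simp: field_simps)
  \<comment> \<open>From this bound on, the maximum is attained, so bounding one optimal triple
    \<open>r\<close>, \<open>a\<close>, \<open>b\<close> suffices.\<close>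
  have "1 / real q \<le> p"
  proof -
    have "real (Suc k) * p \<le> real q * p" using kq assms(2) by (intro mult_right_mono) auto
    with kp(2) show ?thesis using q2 by (simp add: field_simps)
  qed
  then obtain r and a b :: "'a \<Rightarrow> 'a" where r: "r \<in> chsh_inputs p"
    and v: "chsh_value TYPE('a) p = chsh_win r a b"
    using chsh_value_is_max(1)[where 'a = 'a] assms(1) by blast
  have "(\<Sum>x\<in>UNIV. pmf r x * real (card {y. a x + b y = x * y}))
      \<le> p * real q + real k * (1 - (real k + 1) * p / 2)"
  proof (rule weighted_sum_le_of_bounded_weights)
    show "(\<Sum>x\<in>S. real (card {y. a x + b y = x * y})) \<le> real q + real (card S choose 2)" for S
      using sum_winning_inputs_le[of a b S] unfolding assms(1)
      by (simp flip: of_nat_sum of_nat_add)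
    show "sum (pmf r) UNIV = 1" by (rule sum_pmf_eq_1) auto
  qed (use r kp kq assms(1) in \<open>auto simp: chsh_inputs_iff\<close>)
  then have "chsh_win r a b \<le> (p * real q + real k * (1 - (real k + 1) * p / 2)) / real q"
    by (simp add: chsh_win_eq assms(1) divide_right_mono)
  also have "\<dots> = p + (real_of_int n - 1) / real q * (1 - real_of_int n * p / 2)"
    using q2 k by (simp add: field_simps)
  finally show ?thesis by (simp add: v)
qed

end
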